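(* Let $K,M\in\mathbb{S}^n$ and let $\gamma>0$ be a real number such that the matrix $K-\gamma M$ is nonsingular. Then there exists a nonsingular matrix $U\in\mathbb{R}^{n\times n}$ such that $U^{\mathrm T}KU$ and $U^{\mathrm T}MU$ are both tridiagonal. Moreover, $U$ can be taken such that, for every $i\in\{1,\dots,n-1\}$, the set $\{[U^{\mathrm T}KU]_{i,i+1},\,[U^{\mathrm T}MU]_{i,i+1}\}$ is sign-definite.
   Context: $\mathbb{S}^n$ is the space of real symmetric $n\times n$ matrices; $[M]_{ij}$ is the $(i,j)$ entry of $M$. A symmetric matrix is tridiagonal if all its entries $(i,j)$ with $|i-j|\ge 2$ are zero. A finite set of real numbers is sign-definite if its members are either all nonnegative or all nonpositive. *)

theory Defs
  imports Complex_Main "Jordan_Normal_Form.Matrix"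
begin

definition symmetric_mat :: "'a mat \<Rightarrow> bool" where
  "symmetric_mat A \<longleftrightarrow> A\<^sup>T = A"

text \<open>Matrix indices start at 0. The distance of two indices is taken in the integers,
  since subtraction of natural numbers truncates.\<close>

definition tridiagonal_mat :: "real mat \<Rightarrow> bool" where
  "tridiagonal_mat A \<longleftrightarrow> symmetric_mat A \<and>
     (\<forall>i < dim_row A. \<forall>j < dim_col A. \<bar>int i - int j\<bar> \<ge> 2 \<longrightarrow> A $$ (i, j) = 0)"

definition sign_definite :: "real set \<Rightarrow> bool" where
  "sign_definite S \<longleftrightarrow> finite S \<and> ((\<forall>x\<in>S. x \<ge> 0) \<or> (\<forall>x\<in>S. x \<le> 0))"

end

theory Submission
  imports Defs "Jordan_Normal_Form.Determinant" "HOL-Computational_Algebra.Field_as_Ring"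
    "HOL-Library.Function_Algebras"
begin

text \<open>Put \<open>S = K - \<gamma> M\<close> and \<open>T = S\<inverse> M\<close>, which is self-adjoint for the form \<open>S\<close>. It suffices to find
  an \<open>S\<close>-orthogonal basis in which \<open>M\<close> is tridiagonal: the off-diagonal entries of \<open>K\<close> are then
  \<open>\<gamma>\<close> times those of \<open>M\<close>. Such a basis comes from the Lanczos process, whose possible breakdown
  in the indefinite case is handled by choosing the start vector well. Let \<open>k\<close> be maximal such that
  some \<open>v\<close> has nonzero Hankel determinants \<open>det (S (T\<^sup>i v) (T\<^sup>j v))\<close> up to order \<open>k\<close>, and let \<open>c\<close> be
  the \<open>k\<close>-th orthogonal polynomial of \<open>v\<close>. Near \<open>v\<close> the determinant of order \<open>k + 1\<close> vanishes;
  differentiating gives \<open>c(T)\<^sup>2 v = 0\<close>, hence \<open>c(T) v\<close> is orthogonal to the Krylov space of \<open>v\<close>. It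
  follows that the monic multiple of \<open>c\<close> divides any polynomial annihilating \<open>T\<close>, so it takes
  finitely many values near \<open>v\<close>, and this forces \<open>c(T) v = 0\<close>. Thus the process stops
  at an invariant nondegenerate subspace, and one continues in its orthogonal complement.\<close>

section \<open>Finiteness of the set of monic divisors\<close>

lemma finite_submultisets: "finite {A. A \<subseteq># B}"
proof (induction B)
  case (add x B)
  have "{A. A \<subseteq># add_mset x B} \<subseteq> {A. A \<subseteq># B} \<union> add_mset x ` {A. A \<subseteq># B}"
  proof (intro subsetI, clarify)
    fix A assume A: "A \<subseteq># add_mset x B" "A \<notin> add_mset x ` {A. A \<subseteq># B}"
    show "A \<subseteq># B"
    proof (cases "x \<in># A")
      case True
      then obtain A' where "A = add_mset x A'" by (metis multi_member_split)
      with A show ?thesis by auto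
    next
      case False
      with A(1) show ?thesis
        by (metis diff_single_trivial subset_eq_diff_conv add_mset_add_single)
    qed
  qed
  with add show ?case by (meson finite_Un finite_imageI finite_subset)
qed auto

text \<open>A normalized divisor is recovered from its prime factorization, which is one of the
  finitely many submultisets of that of \<open>x\<close>.\<close>

lemma finite_normalized_divisors:
  fixes x :: "'a::factorial_semiring"
  assumes "x \<noteq> 0"
  shows "finite {y. y dvd x \<and> normalize y = y}"
proof (rule finite_subset)
  show "{y. y dvd x \<and> normalize y = y}
      \<subseteq> (\<lambda>A. normalize (prod_mset A)) ` {A. A \<subseteq># prime_factorization x}"
  proof clarify
    fix y assume y: "y dvd x" "normalize y = y"
    with assms have "y \<noteq> 0" by auto
    then have "normalize (prod_mset (prime_factorization y)) = y"
      using prod_mset_prime_factorization_weak[of y] y by simp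
    moreover have "prime_factorization y \<subseteq># prime_factorization x"
      using y assms \<open>y \<noteq> 0\<close> by (simp add: prime_factorization_subset_iff_dvd)
    ultimately show "y \<in> (\<lambda>A. normalize (prod_mset A)) ` {A. A \<subseteq># prime_factorization x}"
      by (metis (mono_tags, lifting) image_eqI mem_Collect_eq)
  qed
  show "finite ((\<lambda>A. normalize (prod_mset A)) ` {A. A \<subseteq># prime_factorization x})"
    by (intro finite_imageI finite_submultisets)
qed

lemma finite_monic_divisors:
  fixes p :: "real poly"
  assumes "p \<noteq> 0"
  shows "finite {q. q dvd p \<and> lead_coeff q = 1}"
proof (rule finite_subset[OF _ finite_normalized_divisors[OF assms]])
  show "{q. q dvd p \<and> lead_coeff q = 1} \<subseteq> {q. q dvd p \<and> normalize q = q}"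
    by (auto simp: normalize_poly_eq_map_poly map_poly_idI)
qed

section \<open>Auxiliary linear algebra\<close>

lemma continuous_on_det:
  fixes A :: "'t::topological_space \<Rightarrow> real mat"
  assumes "\<And>t. A t \<in> carrier_mat n n"
    and "\<And>i j. i < n \<Longrightarrow> j < n \<Longrightarrow> continuous_on X (\<lambda>t. A t $$ (i, j))"
  shows "continuous_on X (\<lambda>t. det (A t))"
proof -
  have "continuous_on X (\<lambda>t. \<Sum>p | p permutes {0..<n}. signof p * (\<Prod>i = 0..<n. A t $$ (i, p i)))"
    by (intro continuous_intros assms) (auto dest: permutes_in_image)
  then show ?thesis
    by (simp add: det_def'[OF assms(1)])
qed

text \<open>Padding the coefficients with zero rows gives a singular square matrix, row
  \<open>n\<close> being zero; a kernel vector of it is the solution.\<close>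

lemma underdetermined_system_nontrivial:
  fixes a :: "nat \<Rightarrow> nat \<Rightarrow> 'a::field"
  assumes "n < m"
  obtains c where "\<exists>i<m. c i \<noteq> 0" "\<And>r. r < n \<Longrightarrow> (\<Sum>i<m. a r i * c i) = 0"
proof -
  define A where "A = mat m m (\<lambda>(r, i). if r < n then a r i else 0)"
  have A: "A \<in> carrier_mat m m" by (simp add: A_def)
  have "row A n = 0\<^sub>v m" using assms by (auto simp: A_def)
  then have "det A = 0"
    using A assms by (subst laplace_expansion_row[OF A assms]) (auto simp: A_def)
  then obtain v where v: "v \<in> carrier_vec m" "v \<noteq> 0\<^sub>v m" "A *\<^sub>v v = 0\<^sub>v m"
    using det_0_iff_vec_prod_zero_field[OF A] by auto
  show ?thesis
  proof (rule that[of "\<lambda>i. v $ i"])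
    show "\<exists>i<m. v $ i \<noteq> 0" using v by (metis carrier_vecD eq_vecI index_zero_vec)
    fix r assume r: "r < n"
    have "(\<Sum>i<m. a r i * v $ i) = (A *\<^sub>v v) $ r"
      using r assms v(1) by (simp add: A_def scalar_prod_def lessThan_atLeast0)
    then show "(\<Sum>i<m. a r i * v $ i) = 0" using v(3) r assms by simp
  qed
qed

lemma coeff_sum_monom: "coeff (\<Sum>i\<le>k. monom (a i) i) j = (if j \<le> k then a j else 0)"
  by (simp add: coeff_sum)

section \<open>Polynomials in a self-adjoint operator\<close>

locale selfadjoint_operator = vector_space scale
  for scale :: "real \<Rightarrow> 'b::ab_group_add \<Rightarrow> 'b" (infixr "*s" 75) +
  fixes S :: "'b \<Rightarrow> 'b \<Rightarrow> real" and T :: "'b \<Rightarrow> 'b"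
  assumes S_add: "S (x + y) z = S x z + S y z"
    and S_scale: "S (a *s x) z = a * S x z"
    and S_sym: "S x y = S y x"
    and T_add: "T (x + y) = T x + T y"
    and T_scale: "T (a *s x) = a *s T x"
    and T_selfadjoint: "S (T x) y = S x (T y)"
begin

lemma S_add_right: "S z (x + y) = S z x + S z y"
  by (metis S_add S_sym)

lemma S_scale_right: "S z (a *s x) = a * S z x"
  by (metis S_scale S_sym)

lemma S_0 [simp]: "S 0 x = 0" "S x 0 = 0"
  using S_scale[of 0 x x] S_sym by (metis S_scale mult_zero_left scale_zero_left)+

lemma T_0 [simp]: "T 0 = 0"
  using T_scale[of 0 0] by simp

lemma S_sum: "S (\<Sum>i\<in>I. f i) z = (\<Sum>i\<in>I. S (f i) z)"
  by (induction I rule: infinite_finite_induct) (auto simp: S_add)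

text \<open>This is the vector f(T) x, evaluated by Horner's scheme.\<close>

definition act :: "real poly \<Rightarrow> 'b \<Rightarrow> 'b" where
  "act f x = fold_coeffs (\<lambda>a y. a *s x + T y) f 0"

lemma act_0 [simp]: "act 0 x = 0"
  by (simp add: act_def)

lemma act_pCons: "act (pCons a f) x = a *s x + T (act f x)"
  by (cases "a = 0 \<and> f = 0")
     (auto simp: act_def fold_coeffs_pCons_coeff_not_0_eq fold_coeffs_pCons_not_0_0_eq)

lemma act_1 [simp]: "act 1 x = x"
  by (simp add: one_pCons act_pCons)

lemma act_add_poly: "act (f + g) x = act f x + act g x"
proof (induction f g rule: poly_induct2)
  case (pCons a p b q)
  then show ?case by (simp add: act_pCons T_add algebra_simps)
qed simp

lemma act_smult: "act (smult c f) x = c *s act f x"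
  by (induction f) (auto simp: act_pCons T_scale algebra_simps)

lemma act_add: "act f (x + y) = act f x + act f y"
  by (induction f) (auto simp: act_pCons T_add algebra_simps)

lemma act_scale: "act f (c *s x) = c *s act f x"
  by (induction f) (auto simp: act_pCons T_scale algebra_simps)

lemma act_T: "act f (T x) = T (act f x)"
  by (induction f) (auto simp: act_pCons T_add T_scale)

lemma act_mult: "act (f * g) x = act f (act g x)"
  by (induction f) (auto simp: act_pCons act_add_poly act_smult)

lemma act_sum_poly: "act (\<Sum>i\<in>I. f i) x = (\<Sum>i\<in>I. act (f i) x)"
  by (induction I rule: infinite_finite_induct) (auto simp: act_add_poly)

lemma S_act: "S (act f x) y = S x (act f y)"
  by (induction f arbitrary: y)
     (auto simp: act_pCons S_add S_scale S_add_right S_scale_right T_selfadjoint act_T)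

lemma S_act_add: "S (act (f + g) x) y = S (act f x) y + S (act g x) y"
  by (simp add: act_add_poly S_add)

lemma S_act_diff: "S (act (f - g) x) y = S (act f x) y - S (act g x) y"
  using S_act_add[of "f - g" g x y] by simp

lemma S_act_smult: "S (act (smult c f) x) y = c * S (act f x) y"
  by (simp add: act_smult S_scale)

text \<open>The bound \<open>k\<close> may exceed the degree, so the index range can stay fixed
  while \<open>f\<close> varies with a parameter.\<close>

lemma S_act_expand:
  assumes "degree f \<le> k"
  shows "S (act (f * g) x) y = (\<Sum>i\<le>k. coeff f i * S (act (monom 1 i * g) x) y)"
proof -
  have "f * g = (\<Sum>i\<le>k. smult (coeff f i) (monom 1 i * g))"
    using poly_as_sum_of_monoms'[OF assms]
    by (metis (no_types, lifting) sum.cong sum_distrib_right mult_smult_left mult.right_neutral smult_monom)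
  then show ?thesis
    by (simp add: act_sum_poly S_sum S_act_smult)
qed

text \<open>The two mixed terms agree because f(T) is self-adjoint, which leaves a quadratic
  polynomial in \<open>t\<close>.\<close>

lemma S_act_line:
  "S (act f (v + t *s u)) (v + t *s u)
     = S (act f v) v + 2 * t * S (act f v) u + t\<^sup>2 * S (act f u) u"
proof -
  have "S (act f u) v = S (act f v) u" by (metis S_act S_sym)
  then show ?thesis
    by (simp add: act_add act_scale S_add S_add_right S_scale S_scale_right
        power2_eq_square algebra_simps)
qed

section \<open>Hankel determinants and orthogonal polynomials\<close>

text \<open>By self-adjointness this is the Gram matrix of the Krylov vectors v, T v, ..., T^(k-1)
  v.\<close>

definition hankel :: "nat \<Rightarrow> 'b \<Rightarrow> real mat" where
  "hankel k v = mat k k (\<lambda>(i, j). S (act (monom 1 (i + j)) v) v)"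

definition hdet :: "nat \<Rightarrow> 'b \<Rightarrow> real" where
  "hdet k v = det (hankel k v)"

text \<open>The last column of the adjugate of the Hankel matrix of order \<open>k + 1\<close>, read as a
  polynomial: up to scaling the \<open>k\<close>-th orthogonal polynomial of the functional
  \<open>f \<mapsto> S (act f v) v\<close>.\<close>

definition orthpoly :: "nat \<Rightarrow> 'b \<Rightarrow> real poly" where
  "orthpoly k v = (\<Sum>i\<le>k. monom (cofactor (hankel (Suc k) v) k i) i)"

lemma hankel_carrier: "hankel k v \<in> carrier_mat k k"
  by (simp add: hankel_def)

lemma hdet_0 [simp]: "hdet 0 v = 1"
  by (simp add: hdet_def hankel_def)

lemma coeff_orthpoly:
  "coeff (orthpoly k v) i = (if i \<le> k then cofactor (hankel (Suc k) v) k i else 0)"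
  by (simp add: orthpoly_def coeff_sum_monom)

lemma degree_orthpoly_le: "degree (orthpoly k v) \<le> k"
  by (rule degree_le) (simp add: coeff_orthpoly)

lemma coeff_orthpoly_top: "coeff (orthpoly k v) k = hdet k v"
proof -
  have "mat_delete (hankel (Suc k) v) k k = hankel k v"
    by (rule eq_matI) (auto simp: mat_delete_def hankel_def)
  then show ?thesis
    by (simp add: coeff_orthpoly cofactor_def hdet_def)
qed

text \<open>Row \<open>i\<close> of the Hankel matrix against the cofactors of row \<open>k\<close>
  is an entry of the matrix times its adjugate, that is, of the determinant times the
  identity.\<close>

lemma orthpoly_orth_monom:
  assumes "i \<le> k"
  shows "S (act (monom 1 i * orthpoly k v) v) v = (if i = k then hdet (Suc k) v else 0)"
proof -
  let ?H = "hankel (Suc k) v"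
  have "S (act (orthpoly k v * monom 1 i) v) v
      = (\<Sum>j\<le>k. coeff (orthpoly k v) j * S (act (monom 1 j * monom 1 i) v) v)"
    by (rule S_act_expand) (rule degree_orthpoly_le)
  also have "\<dots> = (\<Sum>j<Suc k. ?H $$ (i, j) * cofactor ?H k j)"
    using assms by (intro sum.cong) (auto simp: coeff_orthpoly hankel_def mult_monom add.commute)
  also have "\<dots> = (?H * adj_mat ?H) $$ (i, k)"
    using assms by (simp add: adj_mat_def hankel_def scalar_prod_def lessThan_atLeast0)
  also have "\<dots> = (if i = k then hdet (Suc k) v else 0)"
    using assms by (simp add: adj_mat(2)[OF hankel_carrier] hdet_def)
  finally show ?thesis by (simp add: mult.commute)
qed

lemma orthpoly_orth:
  assumes "degree f \<le> k"
  shows "S (act (f * orthpoly k v) v) v = coeff f k * hdet (Suc k) v"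
proof -
  have "S (act (f * orthpoly k v) v) v
      = (\<Sum>i\<le>k. coeff f i * (if i = k then hdet (Suc k) v else 0))"
    by (subst S_act_expand[OF assms], intro sum.cong) (simp_all add: orthpoly_orth_monom)
  then show ?thesis by (simp add: if_distrib cong: if_cong)
qed

lemma orthpoly_orth_less:
  assumes "degree f < k"
  shows "S (act (f * orthpoly k v) v) v = 0"
  using orthpoly_orth[of f k v] assms by (simp add: coeff_eq_0)

text \<open>The coefficients of \<open>f\<close> form a kernel vector of a nonsingular Hankel
  matrix. The case \<open>f = 0\<close> stands apart because the zero polynomial has degree 0, which
  is not below \<open>k\<close> when \<open>k = 0\<close>.\<close>

lemma hankel_kernel:
  assumes "hdet k v \<noteq> 0" "f = 0 \<or> degree f < k"
    and "\<And>i. i < k \<Longrightarrow> S (act (monom 1 i * f) v) v = 0"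
  shows "f = 0"
proof (rule ccontr)
  assume f: "f \<noteq> 0"
  with assms have deg: "degree f < k" by simp
  define x where "x = vec k (coeff f)"
  have "x $ degree f \<noteq> 0" using f deg by (simp add: x_def)
  then have "x \<noteq> 0\<^sub>v k" using deg by auto
  moreover have "hankel k v *\<^sub>v x = 0\<^sub>v k"
  proof (rule eq_vecI)
    fix i assume "i < dim_vec (0\<^sub>v k :: real vec)"
    then have i: "i < k" by simp
    have "(hankel k v *\<^sub>v x) $ i = (\<Sum>j<k. S (act (monom 1 (i + j)) v) v * coeff f j)"
      using i by (simp add: hankel_def x_def scalar_prod_def lessThan_atLeast0)
    \<comment> \<open>Since \<open>i < k\<close>, \<open>k\<close> is positive and the truncated
      \<open>k-1\<close> is the true predecessor.\<close>
    also have "\<dots> = (\<Sum>j\<le>k-1. coeff f j * S (act (monom 1 j * monom 1 i) v) v)"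
      using i by (intro sum.cong) (auto simp: mult_monom add.commute)
    also have "\<dots> = S (act (f * monom 1 i) v) v"
      using deg by (subst S_act_expand[of f "k - 1"]) auto
    also have "\<dots> = 0" using assms(3)[OF i] by (simp add: mult.commute)
    finally show "(hankel k v *\<^sub>v x) $ i = 0\<^sub>v k $ i" using i by simp
  qed (simp add: hankel_def)
  moreover have "x \<in> carrier_vec k" by (simp add: x_def)
  ultimately have "det (hankel k v) = 0"
    using det_0_iff_vec_prod_zero_field[OF hankel_carrier] by blast
  with assms(1) show False by (simp add: hdet_def)
qed

lemma continuous_S_act_line:
  "continuous_on X (\<lambda>t. S (act f (v + t *s u)) (v + t *s u))"
  unfolding S_act_line by (intro continuous_intros)

lemma continuous_hdet_line: "continuous_on X (\<lambda>t. hdet k (v + t *s u))"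
  unfolding hdet_def
  by (rule continuous_on_det[OF hankel_carrier])
     (auto simp: hankel_def intro: continuous_S_act_line)

lemma continuous_coeff_orthpoly_line:
  "continuous_on X (\<lambda>t. coeff (orthpoly k (v + t *s u)) i)"
proof (cases "i \<le> k")
  case True
  have "continuous_on X (\<lambda>t. det (mat_delete (hankel (Suc k) (v + t *s u)) k i))"
  proof (rule continuous_on_det)
    show "mat_delete (hankel (Suc k) (v + t *s u)) k i \<in> carrier_mat k k" for t
      using mat_delete_carrier[OF hankel_carrier, of "Suc k"] by simp
    show "continuous_on X (\<lambda>t. mat_delete (hankel (Suc k) (v + t *s u)) k i $$ (a, b))"
      if "a < k" "b < k" for a b
      using that by (auto simp: mat_delete_def hankel_def intro: continuous_S_act_line)
  qed
  then show ?thesis using True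
    by (simp add: coeff_orthpoly cofactor_def continuous_on_mult_left)
qed (simp add: coeff_orthpoly)

end

section \<open>Start vectors in an invariant subspace\<close>

text \<open>\<open>V\<close> will be the orthogonal complement of the blocks found so far.
  \<open>P\<close> annihilates \<open>T\<close> only modulo the radical of \<open>S\<close>, which
  is nonzero in the application: there vectors are functions on all naturals, and \<open>S\<close>
  sees finitely many of their values.\<close>

locale invariant_subspace = selfadjoint_operator scale S T
  for scale :: "real \<Rightarrow> 'b::ab_group_add \<Rightarrow> 'b" (infixr "*s" 75) and S T +
  fixes V :: "'b set" and P :: "real poly"
  assumes V_add: "x \<in> V \<Longrightarrow> y \<in> V \<Longrightarrow> x + y \<in> V"
    and V_scale: "x \<in> V \<Longrightarrow> a *s x \<in> V"
    and V_T: "x \<in> V \<Longrightarrow> T x \<in> V"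
    and P_nonzero: "P \<noteq> 0"
    and P_annihilates: "S (act P x) y = 0"
begin

lemma V_act:
  assumes "x \<in> V" shows "act f x \<in> V"
proof (induction f)
  case 0
  show ?case using V_scale[OF assms, of 0] by simp
qed (simp add: act_pCons V_add V_scale V_T assms)

text \<open>The Lanczos process started at \<open>v\<close> survives \<open>k\<close> steps: its
  first \<open>k\<close> vectors have nonzero square, the square of the one of index i being
  \<open>hdet i v * hdet (Suc i) v\<close>.\<close>

definition admissible :: "nat \<Rightarrow> 'b \<Rightarrow> bool" where
  "admissible k v \<longleftrightarrow> v \<in> V \<and> (\<forall>j\<le>k. hdet j v \<noteq> 0)"

text \<open>For larger \<open>k\<close> the coefficients of \<open>P\<close> would lie in the kernel
  of a nonsingular Hankel matrix.\<close>

lemma admissible_degree_bound: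
  assumes "admissible k v"
  shows "k \<le> degree P"
proof (rule ccontr)
  assume "\<not> k \<le> degree P"
  moreover have "hdet k v \<noteq> 0" using assms by (simp add: admissible_def)
  moreover have "S (act (monom 1 i * P) v) v = 0" for i
    using P_annihilates[of v "act (monom 1 i) v"] by (simp add: act_mult S_act)
  ultimately have "P = 0" by (intro hankel_kernel[of k v]) auto
  with P_nonzero show False ..
qed

text \<open>Finitely many determinants, all continuous along the line, stay nonzero near
  \<open>t = 0\<close>.\<close>

lemma admissible_eventually:
  assumes "admissible k v" "u \<in> V"
  shows "eventually (\<lambda>t. admissible k (v + t *s u)) (nhds 0)"
proof -
  have "eventually (\<lambda>t. hdet j (v + t *s u) \<noteq> 0) (nhds 0)" if "j \<le> k" for j
  proof -
    have "open {t. hdet j (v + t *s u) \<noteq> 0}"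
      by (intro open_Collect_neq continuous_hdet_line continuous_on_const)
    moreover have "hdet j (v + 0 *s u) \<noteq> 0" using assms that by (simp add: admissible_def)
    ultimately show ?thesis by (auto simp: eventually_nhds)
  qed
  then have "eventually (\<lambda>t. \<forall>j\<in>{..k}. hdet j (v + t *s u) \<noteq> 0) (nhds 0)"
    by (intro eventually_ball_finite) auto
  then show ?thesis
    by (rule eventually_mono) (use assms in \<open>auto simp: admissible_def V_add V_scale\<close>)
qed

section \<open>Orthogonal polynomials of maximal order\<close>

context
  fixes k :: nat
  assumes maximal: "\<And>v. admissible k v \<Longrightarrow> hdet (Suc k) v = 0"
begin

text \<open>With \<open>c\<^sub>t\<close> the orthogonal polynomial at \<open>v + t u\<close>, the value of the functional at
  \<open>v + t u\<close> on \<open>c\<^sub>t c\<^sub>0\<close> vanishes identically near \<open>t = 0\<close>, and so does the constant term of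
  its expansion; after division by \<open>t\<close> the limit \<open>t \<rightarrow> 0\<close> gives the claim.\<close>

lemma orthpoly_square_radical:
  assumes v: "admissible k v" and u: "u \<in> V"
  shows "S (act (orthpoly k v * orthpoly k v) v) u = 0"
proof -
  let ?c = "\<lambda>t. orthpoly k (v + t *s u)"
  define F where "F x y t = S (act (?c t * ?c 0) x) y" for x y t
  have F: "F x y t = (\<Sum>i\<le>k. coeff (?c t) i * S (act (monom 1 i * ?c 0) x) y)" for x y t
    unfolding F_def by (rule S_act_expand) (rule degree_orthpoly_le)
  have cont: "isCont (F x y) 0" for x y
  proof -
    have "continuous_on UNIV (F x y)"
      unfolding F by (intro continuous_intros continuous_coeff_orthpoly_line)
    then show ?thesis by (simp add: continuous_on_eq_continuous_at)
  qed
  have "eventually (\<lambda>t. admissible k (v + t *s u)) (at 0)"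
    using admissible_eventually[OF v u] by (simp add: eventually_nhds_conv_at)
  then have "eventually (\<lambda>t. 2 * F v u t + t * F u u t = 0) (at 0)"
    using eventually_neq_at_within[of 0]
  proof eventually_elim
    case (elim t)
    \<comment> \<open>\<open>?c 0\<close> has degree at most \<open>k\<close>, so orthogonality of
      \<open>?c t\<close> at \<open>v + t *s u\<close> leaves a multiple of the determinant of order
      \<open>Suc k\<close>, zero by maximality there. The next fact exchanges the roles:
      \<open>?c t\<close> is tested against \<open>?c 0\<close> at \<open>v\<close>.\<close>
    have "S (act (?c 0 * ?c t) (v + t *s u)) (v + t *s u) = 0"
      using maximal[OF elim(1)] degree_orthpoly_le by (subst orthpoly_orth) auto
    moreover have "S (act (?c t * ?c 0) v) v = 0"
      using orthpoly_orth[OF degree_orthpoly_le, of k "v + t *s u" v] maximal[OF v] by simp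
    ultimately have "2 * t * F v u t + t\<^sup>2 * F u u t = 0"
      unfolding S_act_line F_def by (simp add: mult.commute)
    then have "t * (2 * F v u t + t * F u u t) = 0"
      by (simp add: power2_eq_square algebra_simps)
    with elim(2) show ?case by simp
  qed
  then have "((\<lambda>t. 2 * F v u t + t * F u u t) \<longlongrightarrow> 0) (at 0)"
    by (rule tendsto_eventually)
  moreover have "((\<lambda>t. 2 * F v u t + t * F u u t) \<longlongrightarrow> 2 * F v u 0 + 0 * F u u 0) (at 0)"
    using cont by (intro tendsto_intros) (auto simp: isCont_def)
  ultimately have "F v u 0 = 0"
    using tendsto_unique[OF at_neq_bot] by fastforce
  then show ?thesis by (simp add: F_def)
qed

lemma degree_orthpoly:
  assumes "admissible k v"
  shows "degree (orthpoly k v) = k" "orthpoly k v \<noteq> 0"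
proof -
  have "coeff (orthpoly k v) k \<noteq> 0"
    using assms by (simp add: coeff_orthpoly_top admissible_def)
  then show "degree (orthpoly k v) = k" "orthpoly k v \<noteq> 0"
    using le_degree[of "orthpoly k v" k] degree_orthpoly_le[of k v] by auto
qed

text \<open>Divide \<open>f\<close> by the orthogonal polynomial c: the multiple of c^2 is killed by
  \<open>orthpoly_square_radical\<close>, the remainder by orthogonality to lower degrees.\<close>

lemma orthpoly_orth_all:
  assumes v: "admissible k v"
  shows "S (act (f * orthpoly k v) v) v = 0"
proof -
  let ?c = "orthpoly k v"
  let ?g = "f div ?c" and ?r = "f mod ?c"
  have "S (act (?g * (?c * ?c)) v) v = 0"
    using orthpoly_square_radical[OF v V_act, of v ?g] v
    by (simp only: act_mult[of ?g] S_act[of ?g]) (simp add: admissible_def S_sym)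
  moreover have "S (act (?r * ?c) v) v = 0"
  proof (cases "?r = 0")
    case False
    then have "degree ?r < k"
      using degree_mod_less[of ?c f] degree_orthpoly[OF v] by auto
    then show ?thesis by (rule orthpoly_orth_less)
  qed simp
  moreover have "f * ?c = ?g * (?c * ?c) + ?r * ?c"
    by (metis div_mult_mod_eq distrib_right mult.assoc)
  ultimately show ?thesis by (simp add: S_act_add)
qed

text \<open>\<open>hdet k v\<close> is the leading coefficient; dividing by it places the
  polynomials of all admissible \<open>v\<close> among the finitely many monic divisors of
  \<open>P\<close>.\<close>

definition monic_orthpoly :: "'b \<Rightarrow> real poly" where
  "monic_orthpoly v = smult (1 / hdet k v) (orthpoly k v)"

lemma monic_orthpoly:
  assumes v: "admissible k v"
  shows "degree (monic_orthpoly v) = k" "lead_coeff (monic_orthpoly v) = 1"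
    "S (act (f * monic_orthpoly v) v) v = 0"
proof -
  have nz: "hdet k v \<noteq> 0" using v by (simp add: admissible_def)
  then show deg: "degree (monic_orthpoly v) = k"
    using degree_orthpoly[OF v] by (simp add: monic_orthpoly_def)
  show "lead_coeff (monic_orthpoly v) = 1"
    using nz by (simp only: deg) (simp add: monic_orthpoly_def coeff_orthpoly_top)
  show "S (act (f * monic_orthpoly v) v) v = 0"
    by (simp add: monic_orthpoly_def S_act_smult orthpoly_orth_all[OF v])
qed

text \<open>Multiples of \<open>P\<close> and of the monic orthogonal polynomial both have value
  zero at \<open>v\<close>, hence so do multiples of the remainder; its degree is below
  \<open>k\<close>, so the nonsingular Hankel matrix forces it to vanish.\<close>

lemma monic_orthpoly_dvd:
  assumes v: "admissible k v"
  shows "monic_orthpoly v dvd P"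
proof -
  let ?q = "monic_orthpoly v"
  have q0: "?q \<noteq> 0" using monic_orthpoly(2)[OF v] by force
  have "P mod ?q = 0"
  proof (rule hankel_kernel[of k v])
    show "hdet k v \<noteq> 0" using v by (simp add: admissible_def)
    show "P mod ?q = 0 \<or> degree (P mod ?q) < k"
      using degree_mod_less[OF q0, of P] monic_orthpoly(1)[OF v] by simp
    fix i
    have "monom 1 i * (P mod ?q) = monom 1 i * P - (monom 1 i * (P div ?q)) * ?q"
      by (simp only: mult.assoc flip: minus_div_mult_eq_mod right_diff_distrib)
    moreover have "S (act (monom 1 i * P) v) v = 0"
      using P_annihilates[of v "act (monom 1 i) v"] by (simp add: act_mult S_act)
    ultimately show "S (act (monom 1 i * (P mod ?q)) v) v = 0"
      using monic_orthpoly(3)[OF v] by (simp add: S_act_diff)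
  qed
  then show ?thesis by (simp add: dvd_eq_mod_eq_0)
qed

text \<open>The monic orthogonal polynomials at the points \<open>v + t u\<close> are divisors of \<open>P\<close>, so one of
  them occurs for infinitely many \<open>t\<close>.\<close>

lemma orthpoly_radical:
  assumes v: "admissible k v" and u: "u \<in> V"
  shows "S (act (orthpoly k v) v) u = 0"
proof -
  let ?q = "\<lambda>t. monic_orthpoly (v + t *s u)"
  let ?A = "{t. admissible k (v + t *s u)}"
  have "infinite ?A"
  proof -
    obtain e where "e > 0" and e: "\<And>t. \<bar>t\<bar> < e \<Longrightarrow> admissible k (v + t *s u)"
      using admissible_eventually[OF v u] by (auto simp: eventually_nhds_metric dist_real_def)
    then have "{0<..<e} \<subseteq> ?A" by auto
    then show ?thesis using \<open>e > 0\<close> by (meson infinite_Ioo infinite_super)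
  qed
  moreover have "finite (?q ` ?A)"
    by (rule finite_subset[OF _ finite_monic_divisors[OF P_nonzero]])
       (auto simp: monic_orthpoly_dvd monic_orthpoly(2))
  ultimately obtain s where "infinite {t \<in> ?A. ?q t = ?q s}"
    using pigeonhole_infinite[of ?A ?q] by auto
  define q where "q = ?q s"
  define A where "A = {t \<in> ?A. ?q t = q}"
  have "infinite A" unfolding A_def q_def by fact
  have zero: "S (act (f * q) v) v = 0 \<and> S (act (f * q) v) u = 0" for f
  proof -
    \<comment> \<open>This is the value at \<open>v + t *s u\<close> as a polynomial in
      \<open>t\<close>. Infinitely many roots make all its coefficients vanish, and the middle one
      carries the pairing with \<open>u\<close>.\<close>
    let ?p = "[:S (act (f * q) v) v, 2 * S (act (f * q) v) u, S (act (f * q) u) u:]"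
    have "poly ?p t = 0" if "t \<in> A" for t
    proof -
      have "S (act (f * q) (v + t *s u)) (v + t *s u) = 0"
        using that monic_orthpoly(3)[of "v + t *s u" f] by (auto simp: A_def)
      then show ?thesis by (simp add: S_act_line power2_eq_square algebra_simps)
    qed
    then have "A \<subseteq> {t. poly ?p t = 0}" by blast
    then have "infinite {t. poly ?p t = 0}" using \<open>infinite A\<close> infinite_super by blast
    then have "?p = 0" using poly_roots_finite by blast
    then show ?thesis by simp
  qed
  obtain t where "t \<in> A" using \<open>infinite A\<close> by (metis finite.emptyI equals0I)
  then have q: "degree q = k" "lead_coeff q = 1"
    using monic_orthpoly[of "v + t *s u"] by (auto simp: A_def)
  \<comment> \<open>The parameter 0 need not belong to \<open>A\<close>, so \<open>q\<close> has to
    be identified at \<open>v\<close> itself: both polynomials are monic of degree \<open>k\<close>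
    and orthogonal to everything there.\<close>
  have "monic_orthpoly v - q = 0"
  proof (rule hankel_kernel[of k v])
    show "hdet k v \<noteq> 0" using v by (simp add: admissible_def)
    show "monic_orthpoly v - q = 0 \<or> degree (monic_orthpoly v - q) < k"
    proof (cases "monic_orthpoly v - q = 0")
      case False
      have "degree (monic_orthpoly v - q) \<le> k"
        using monic_orthpoly(1)[OF v] q(1) by (intro degree_diff_le) auto
      moreover have "coeff (monic_orthpoly v - q) k = 0"
        using monic_orthpoly(1,2)[OF v] q by simp
      ultimately show ?thesis using False
        by (metis le_neq_implies_less leading_coeff_0_iff)
    qed simp
    show "S (act (monom 1 i * (monic_orthpoly v - q)) v) v = 0" for i
      using zero monic_orthpoly(3)[OF v] by (simp add: right_diff_distrib S_act_diff)
  qed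
  then have "S (act (monic_orthpoly v) v) u = 0"
    using zero[of 1] by simp
  then show ?thesis
    using v by (simp add: monic_orthpoly_def S_act_smult admissible_def)
qed

end

section \<open>Tridiagonal blocks from a start vector of maximal order\<close>

text \<open>Order 1 is reached at \<open>x\<close>, because \<open>hdet 1 x\<close> is
  \<open>S x x\<close>, and the degree of \<open>P\<close> bounds all orders. The maximum is taken
  over all start vectors in \<open>V\<close> at once, as the perturbation argument requires.\<close>

lemma maximal_admissible:
  assumes "x \<in> V" "S x x \<noteq> 0"
  obtains k v where "k > 0" "admissible k v" "\<And>w. admissible k w \<Longrightarrow> hdet (Suc k) w = 0"
proof -
  let ?Q = "\<lambda>k. \<exists>v. admissible k v"
  have Q1: "?Q 1"
  proof (intro exI)
    have "hdet (Suc 0) x = S x x"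
      by (simp add: hdet_def hankel_def det_single monom_0 flip: one_pCons)
    with assms show "admissible 1 x" by (auto simp: admissible_def le_Suc_eq)
  qed
  define k where "k = (GREATEST k. ?Q k)"
  have bound: "\<forall>k. ?Q k \<longrightarrow> k \<le> degree P" using admissible_degree_bound by blast
  have Qk: "?Q k" unfolding k_def by (rule GreatestI_nat[where P = ?Q, OF Q1]) (use bound in auto)
  have le: "j \<le> k" if "?Q j" for j
    unfolding k_def by (rule Greatest_le_nat[where P = ?Q, OF that]) (use bound in auto)
  obtain v where v: "admissible k v" using Qk by auto
  show ?thesis
  proof (rule that[OF _ v])
    show "k > 0" using le[OF Q1] by simp
    fix w assume w: "admissible k w"
    show "hdet (Suc k) w = 0"
    proof (rule ccontr)
      assume "hdet (Suc k) w \<noteq> 0"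
      with w have "admissible (Suc k) w" by (auto simp: admissible_def le_Suc_eq)
      with le show False by fastforce
    qed
  qed
qed

text \<open>The block consists of the orthogonal polynomials of degree below \<open>k\<close>
  applied to a vector \<open>v\<close> of maximal order. Applying \<open>T\<close> raises the degree
  by at most one, whence tridiagonality. The last conclusion makes the orthogonal complement of the
  block in \<open>V\<close> invariant under \<open>T\<close>.\<close>

lemma orthogonal_tridiagonal_family:
  assumes "x \<in> V" "S x x \<noteq> 0"
  obtains k e where "k > (0::nat)" "\<And>j. j < k \<Longrightarrow> e j \<in> V"
    "\<And>i j. i < k \<Longrightarrow> j < k \<Longrightarrow> i \<noteq> j \<Longrightarrow> S (e i) (e j) = 0"
    "\<And>i. i < k \<Longrightarrow> S (e i) (e i) \<noteq> 0"
    "\<And>i j. j < k \<Longrightarrow> i + 2 \<le> j \<Longrightarrow> S (T (e i)) (e j) = 0"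
    "\<And>y j. y \<in> V \<Longrightarrow> (\<And>i. i < k \<Longrightarrow> S y (e i) = 0) \<Longrightarrow> j < k \<Longrightarrow> S (T y) (e j) = 0"
proof -
  obtain k v where k: "k > 0" and v: "admissible k v"
    and maximal: "\<And>w. admissible k w \<Longrightarrow> hdet (Suc k) w = 0"
    using maximal_admissible[OF assms] by blast
  have vV: "v \<in> V" and nz: "\<And>j. j \<le> k \<Longrightarrow> hdet j v \<noteq> 0" using v by (auto simp: admissible_def)
  define e where "e j = act (orthpoly j v) v" for j
  have orth: "S (act f v) (e j) = 0" if "degree f < j" for f j
    using orthpoly_orth_less[OF that, of v] by (simp add: e_def act_mult S_act S_sym)
  have T_e: "T (e j) = act (pCons 0 (orthpoly j v)) v" for j
    by (simp add: e_def act_pCons)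
  have less: "S (e i) (e j) = 0" if "i < j" for i j
    using orth[of "orthpoly i v" j] degree_orthpoly_le[of i v] that by (simp add: e_def)
  have span: "S y (act f v) = 0"
    if y: "y \<in> V" "\<And>i. i < k \<Longrightarrow> S y (e i) = 0" and "degree f \<le> k" for y f
    using that(3)
  proof (induction "degree f" arbitrary: f rule: less_induct)
    case less
    define m where "m = degree f"
    \<comment> \<open>\<open>hdet m v\<close> is the leading coefficient of
      \<open>orthpoly m v\<close>, so subtracting this multiple lowers the degree.\<close>
    define a where "a = coeff f m / hdet m v"
    define g where "g = f - smult a (orthpoly m v)"
    have m: "m \<le> k" using less.prems by (simp add: m_def)
    have ey: "S y (e m) = 0"
    \<comment> \<open>\<open>e k\<close> is not among the vectors that \<open>y\<close> is assumed
      orthogonal to; here the radical property at maximal order enters.\<close>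
    proof (cases "m = k")
      case True
      then show ?thesis
        using orthpoly_radical[OF maximal v y(1)] by (simp add: e_def S_sym)
    qed (use m y in auto)
    have f: "f = g + smult a (orthpoly m v)" by (simp add: g_def)
    have "S y (act g v) = 0"
    proof (cases "g = 0")
      case False
      have "degree g \<le> m"
        unfolding g_def using degree_orthpoly_le[of m v]
        by (intro degree_diff_le) (auto simp: m_def intro: order.trans[OF degree_smult_le])
      moreover have "coeff g m = 0"
        using nz[OF m] by (simp add: g_def a_def coeff_orthpoly_top)
      ultimately have "degree g < m" using False
        by (metis le_neq_implies_less leading_coeff_0_iff)
      then show ?thesis using less.hyps[of g] m by (simp add: m_def)
    qed simp
    then show ?case
      using ey by (subst f) (simp add: act_add_poly act_smult S_add_right S_scale_right e_def)
  qed
  show ?thesis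
  proof (rule that[of k e])
    show "k > 0" by fact
    show "e j \<in> V" for j by (simp add: e_def V_act vV)
    show "S (e i) (e j) = 0" if "i \<noteq> j" for i j
      using less[of i j] less[of j i] that by (metis S_sym linorder_neqE_nat)
    show "S (e i) (e i) \<noteq> 0" if "i < k" for i
    proof -
      have "S (e i) (e i) = hdet i v * hdet (Suc i) v"
        using orthpoly_orth[OF degree_orthpoly_le, of i v v]
        by (simp add: e_def act_mult S_act S_sym coeff_orthpoly_top)
      then show ?thesis using nz that by simp
    qed
    show "S (T (e i)) (e j) = 0" if "i + 2 \<le> j" for i j
    proof -
      have "degree (pCons 0 (orthpoly i v)) < j"
        using degree_pCons_le[of 0 "orthpoly i v"] degree_orthpoly_le[of i v] that by linarith
      then show ?thesis unfolding T_e by (rule orth)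
    qed
    show "S (T y) (e j) = 0" if "y \<in> V" "\<And>i. i < k \<Longrightarrow> S y (e i) = 0" "j < k" for y j
    proof -
      have "degree (pCons 0 (orthpoly j v)) \<le> k"
        using degree_pCons_le[of 0 "orthpoly j v"] degree_orthpoly_le[of j v] that by linarith
      from span[OF that(1,2) this] show ?thesis by (simp add: T_selfadjoint T_e)
    qed
  qed
qed

end

section \<open>Gluing blocks to a complete family\<close>

context selfadjoint_operator
begin

text \<open>The third clause covers one side of the band; symmetry gives the other. The last clause,
  invariance of the orthogonal complement under \<open>T\<close>, lets a further block be built
  inside that complement.\<close>

definition tridiagonal_family :: "nat \<Rightarrow> (nat \<Rightarrow> 'b) \<Rightarrow> bool" where
  "tridiagonal_family m e \<longleftrightarrow>
     (\<forall>i<m. S (e i) (e i) \<noteq> 0) \<and>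
     (\<forall>i<m. \<forall>j<m. i \<noteq> j \<longrightarrow> S (e i) (e j) = 0) \<and>
     (\<forall>i<m. \<forall>j<m. i + 2 \<le> j \<longrightarrow> S (T (e i)) (e j) = 0) \<and>
     (\<forall>y. (\<forall>i<m. S y (e i) = 0) \<longrightarrow> (\<forall>i<m. S (T y) (e i) = 0))"

text \<open>A block built inside the complement \<open>V\<close> from the nonisotropic
  \<open>x\<close> is appended. Since \<open>V\<close> is invariant, \<open>T\<close> does not
  couple old and new vectors, so even the entries next to the diagonal vanish at the joint.\<close>

lemma tridiagonal_family_extend:
  assumes fam: "tridiagonal_family m e"
    and P: "P \<noteq> 0" "\<And>x y. S (act P x) y = 0"
    and x: "\<forall>i<m. S x (e i) = 0" "S x x \<noteq> 0"
  obtains m' e' where "m < m'" "tridiagonal_family m' e'"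
proof -
  define V where "V = {x. \<forall>i<m. S x (e i) = 0}"
  have e_nz: "\<And>i. i < m \<Longrightarrow> S (e i) (e i) \<noteq> 0"
    and e_orth: "\<And>i j. i < m \<Longrightarrow> j < m \<Longrightarrow> i \<noteq> j \<Longrightarrow> S (e i) (e j) = 0"
    and e_tri: "\<And>i j. i < m \<Longrightarrow> j < m \<Longrightarrow> i + 2 \<le> j \<Longrightarrow> S (T (e i)) (e j) = 0"
    and V_T: "\<And>y. y \<in> V \<Longrightarrow> T y \<in> V"
    using fam by (simp_all add: tridiagonal_family_def V_def)
  interpret inv: invariant_subspace scale S T V P
    by unfold_locales (use P V_T in \<open>auto simp: V_def S_add S_scale\<close>)
  obtain k g where k: "k > (0::nat)" and gV: "\<And>j. j < k \<Longrightarrow> g j \<in> V"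
    and g_orth: "\<And>i j. i < k \<Longrightarrow> j < k \<Longrightarrow> i \<noteq> j \<Longrightarrow> S (g i) (g j) = 0"
    and g_nz: "\<And>i. i < k \<Longrightarrow> S (g i) (g i) \<noteq> 0"
    and g_tri: "\<And>i j. j < k \<Longrightarrow> i + 2 \<le> j \<Longrightarrow> S (T (g i)) (g j) = 0"
    and g_T: "\<And>y j. y \<in> V \<Longrightarrow> (\<And>i. i < k \<Longrightarrow> S y (g i) = 0) \<Longrightarrow> j < k \<Longrightarrow> S (T y) (g j) = 0"
    using inv.orthogonal_tridiagonal_family[of x] x by (auto simp: V_def)
  define h where "h i = (if i < m then e i else g (i - m))" for i
  have ge: "S (g i) (e j) = 0" "S (e j) (g i) = 0" "S (T (e j)) (g i) = 0"
    if "i < k" "j < m" for i j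
  proof -
    have gi: "g i \<in> V" by (rule gV) fact
    then show "S (g i) (e j) = 0" using that by (simp add: V_def)
    then show "S (e j) (g i) = 0" by (simp add: S_sym)
    \<comment> \<open>\<open>T\<close> is moved over to \<open>g i\<close>, which it keeps inside
      \<open>V\<close>.\<close>
    have "S (T (g i)) (e j) = 0" using V_T[OF gi] that by (simp add: V_def)
    then show "S (T (e j)) (g i) = 0" by (metis S_sym T_selfadjoint)
  qed
  show ?thesis
  proof (rule that)
    show "m < m + k" using k by simp
    show "tridiagonal_family (m + k) h"
      unfolding tridiagonal_family_def
    proof (intro conjI allI impI)
      fix i assume i: "i < m + k"
      show "S (h i) (h i) \<noteq> 0"
        using e_nz[of i] g_nz[of "i - m"] i by (auto simp: h_def)
      fix j assume j: "j < m + k"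
      show "S (h i) (h j) = 0" if "i \<noteq> j"
      proof -
        have "i - m \<noteq> j - m" if "\<not> i < m" "\<not> j < m" using that \<open>i \<noteq> j\<close> by linarith
        then show ?thesis using i j that
          by (auto simp: h_def intro!: e_orth g_orth ge)
      qed
      show "S (T (h i)) (h j) = 0" if "i + 2 \<le> j"
      proof (cases "i < m")
        case True
        then show ?thesis using j that by (auto simp: h_def intro!: e_tri ge)
      next
        case False
        have "S (T (g (i - m))) (g (j - m)) = 0"
          by (rule g_tri) (use False j that in linarith)+
        then show ?thesis using False that by (simp add: h_def)
      qed
    next
      fix y i assume y: "\<forall>i<m + k. S y (h i) = 0" and i: "i < m + k"
      have "S y (e j) = 0" if "j < m" for j
        using y[rule_format, of j] that by (simp add: h_def)
      then have yV: "y \<in> V" by (simp add: V_def)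
      have yg: "S y (g j) = 0" if "j < k" for j
        using y[rule_format, of "m + j"] that by (simp add: h_def)
      show "S (T y) (h i) = 0"
      proof (cases "i < m")
        case True
        then show ?thesis using V_T[OF yV] by (simp add: h_def V_def)
      next
        case False
        then have "i - m < k" using i by linarith
        then show ?thesis using g_T[OF yV yg] False by (simp add: h_def)
      qed
    qed
  qed
qed

text \<open>For a family of maximal size no vector of the complement has nonzero square, so by
  polarization \<open>S\<close> vanishes on the complement; any \<open>y\<close> differs from a
  vector of the complement by a combination of the family.\<close>

lemma complete_tridiagonal_family:
  assumes P: "P \<noteq> 0" "\<And>x y. S (act P x) y = 0"
    and bound: "\<And>m e. tridiagonal_family m e \<Longrightarrow> m \<le> n"
  obtains m e where "tridiagonal_family m e" "\<And>x y. (\<And>i. i < m \<Longrightarrow> S x (e i) = 0) \<Longrightarrow> S x y = 0"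
proof -
  let ?Q = "\<lambda>m. \<exists>e. tridiagonal_family m e"
  have Q0: "?Q 0" by (simp add: tridiagonal_family_def)
  define m where "m = (GREATEST m. ?Q m)"
  have bd: "\<forall>m. ?Q m \<longrightarrow> m \<le> n" using bound by blast
  have "?Q m" unfolding m_def by (rule GreatestI_nat[where P = ?Q, OF Q0]) (use bd in auto)
  then obtain e where fam: "tridiagonal_family m e" by auto
  have le: "j \<le> m" if "?Q j" for j
    unfolding m_def by (rule Greatest_le_nat[where P = ?Q, OF that]) (use bd in auto)
  have e_nz: "\<And>i. i < m \<Longrightarrow> S (e i) (e i) \<noteq> 0"
    and e_orth: "\<And>i j. i < m \<Longrightarrow> j < m \<Longrightarrow> i \<noteq> j \<Longrightarrow> S (e i) (e j) = 0"
    using fam by (simp_all add: tridiagonal_family_def)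
  have isotropic: "S x x = 0" if "\<And>i. i < m \<Longrightarrow> S x (e i) = 0" for x
  proof (rule ccontr)
    assume "S x x \<noteq> 0"
    with that obtain m' e' where "m < m'" "tridiagonal_family m' e'"
      using tridiagonal_family_extend[OF fam P, of x] by blast
    with le[of m'] show False by auto
  qed
  have "S x y = 0" if x: "\<And>i. i < m \<Longrightarrow> S x (e i) = 0" for x y
  proof -
    \<comment> \<open>Minus the orthogonal projection of \<open>y\<close> to the span of the family,
      so that \<open>y + p\<close> lies in the complement.\<close>
    define p where "p = (\<Sum>i<m. (- S y (e i) / S (e i) (e i)) *s e i)"
    define z where "z = y + p"
    have z: "S z (e j) = 0" if j: "j < m" for j
    proof -
      have "S p (e j) = (\<Sum>i<m. - S y (e i) / S (e i) (e i) * S (e i) (e j))"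
        by (simp only: p_def S_sum S_scale)
      also have "\<dots> = (\<Sum>i<m. if i = j then - S y (e j) else 0)"
        using e_nz e_orth j by (intro sum.cong) auto
      finally show ?thesis using j by (simp add: z_def S_add)
    qed
    have "S (x + z) (x + z) = 0" "S x x = 0" "S z z = 0"
      by (rule isotropic; simp add: S_add x z)+
    then have "S x z = 0"
      by (simp add: S_add S_add_right S_sym[of z x])
    moreover have "S p x = 0"
      unfolding p_def S_sum S_scale by (simp add: S_sym[of _ x] x)
    ultimately show ?thesis by (simp add: z_def S_add_right S_sym[of x p])
  qed
  with fam show ?thesis by (rule that)
qed

end

section \<open>Symmetric matrices as forms on functions\<close>

text \<open>Vectors are functions on the naturals, a group under pointwise addition as the locales
  demand; only their values below \<open>n\<close> count.\<close>

definition mat_form :: "nat \<Rightarrow> real mat \<Rightarrow> (nat \<Rightarrow> real) \<Rightarrow> (nat \<Rightarrow> real) \<Rightarrow> real" where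
  "mat_form n A x y = (\<Sum>i<n. \<Sum>j<n. A $$ (i, j) * x i * y j)"

definition unit_fun :: "nat \<Rightarrow> nat \<Rightarrow> real" where
  "unit_fun a = (\<lambda>i. if i = a then 1 else 0)"

lemma symmetric_mat_index:
  assumes "symmetric_mat A" "A \<in> carrier_mat n n" "i < n" "j < n"
  shows "A $$ (i, j) = A $$ (j, i)"
  using assms by (metis symmetric_mat_def carrier_matD index_transpose_mat(1))

lemma mat_form_sym:
  assumes "symmetric_mat A" "A \<in> carrier_mat n n"
  shows "mat_form n A x y = mat_form n A y x"
proof -
  have "mat_form n A x y = (\<Sum>i<n. \<Sum>j<n. A $$ (j, i) * y j * x i)"
    unfolding mat_form_def
    by (intro sum.cong refl) (use symmetric_mat_index[OF assms] in \<open>simp add: mult_ac\<close>)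
  also have "\<dots> = mat_form n A y x" unfolding mat_form_def by (rule sum.swap)
  finally show ?thesis .
qed

lemma mat_form_unit_right:
  "mat_form n A x y = (\<Sum>b<n. y b * mat_form n A x (unit_fun b))"
proof -
  have "mat_form n A x y = (\<Sum>b<n. \<Sum>i<n. A $$ (i, b) * x i * y b)"
    unfolding mat_form_def by (rule sum.swap)
  also have "\<dots> = (\<Sum>b<n. y b * mat_form n A x (unit_fun b))"
    by (intro sum.cong refl)
       (simp add: mat_form_def unit_fun_def sum_distrib_left mult_ac if_distrib cong: if_cong)
  finally show ?thesis .
qed

lemma congruence_index:
  fixes e :: "nat \<Rightarrow> nat \<Rightarrow> real"
  assumes "A \<in> carrier_mat n n" "i < n" "j < n"
  shows "((mat n n (\<lambda>(r, c). e c r))\<^sup>T * A * mat n n (\<lambda>(r, c). e c r)) $$ (i, j)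
    = mat_form n A (e i) (e j)"
proof -
  have "((mat n n (\<lambda>(r, c). e c r))\<^sup>T * A * mat n n (\<lambda>(r, c). e c r)) $$ (i, j)
      = (\<Sum>b<n. (\<Sum>a<n. e i a * A $$ (a, b)) * e j b)"
    using assms by (simp add: scalar_prod_def lessThan_atLeast0)
  also have "\<dots> = (\<Sum>b<n. \<Sum>a<n. A $$ (a, b) * e i a * e j b)"
    by (simp add: sum_distrib_left mult_ac)
  also have "\<dots> = mat_form n A (e i) (e j)"
    unfolding mat_form_def by (rule sum.swap)
  finally show ?thesis .
qed

lemma sum_fun_apply: "(\<Sum>i\<in>I. f i) x = (\<Sum>i\<in>I. f i x)"
  by (induction I rule: infinite_finite_induct) auto

lemma invertible_mat_iff_det:
  fixes A :: "'a::field mat"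
  assumes A: "A \<in> carrier_mat n n"
  shows "invertible_mat A \<longleftrightarrow> det A \<noteq> 0"
proof
  assume "invertible_mat A"
  then obtain B where B: "A * B = 1\<^sub>m n" "B * A = 1\<^sub>m (dim_row B)"
    using A by (auto simp: invertible_mat_def inverts_mat_def)
  have "B \<in> carrier_mat n n"
    using A B by (metis carrier_matD(2) carrier_matI index_mult_mat(2,3) index_one_mat(2,3))
  then have "det A * det B = 1" using B(1) by (metis A det_mult det_one)
  then show "det A \<noteq> 0" by auto
next
  assume "det A \<noteq> 0"
  moreover define B where "B = (1 / det A) \<cdot>\<^sub>m adj_mat A"
  ultimately have "A * B = 1\<^sub>m n" "B * A = 1\<^sub>m n" "B \<in> carrier_mat n n"
    using adj_mat[OF A] A
    by (auto simp: mult_smult_distrib[OF A] mult_smult_assoc_mat[OF _ A] intro!: eq_matI)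
  then show "invertible_mat A"
    using A by (auto simp: invertible_mat_def inverts_mat_def)
qed

text \<open>With \<open>S\<close> the form of \<open>A\<close> and \<open>T\<close> the operator of
  the inverse of \<open>A\<close> times \<open>M\<close>, \<open>S (T x) y\<close> is the form of
  \<open>M\<close>. A complete family has at most \<open>n\<close> members by linear independence,
  and at least \<open>n\<close> because \<open>A\<close> is nonsingular.\<close>

lemma diagonal_tridiagonal_basis:
  fixes A M :: "real mat"
  assumes A: "A \<in> carrier_mat n n" "symmetric_mat A" "invertible_mat A"
    and M: "M \<in> carrier_mat n n" "symmetric_mat M"
  obtains e :: "nat \<Rightarrow> nat \<Rightarrow> real"
  where "\<And>i. i < n \<Longrightarrow> mat_form n A (e i) (e i) \<noteq> 0"
    "\<And>i j. i < n \<Longrightarrow> j < n \<Longrightarrow> i \<noteq> j \<Longrightarrow> mat_form n A (e i) (e j) = 0"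
    "\<And>i j. i < n \<Longrightarrow> j < n \<Longrightarrow> i + 2 \<le> j \<Longrightarrow> mat_form n M (e i) (e j) = 0"
proof -
  obtain A' where A': "A * A' = 1\<^sub>m n" "A' * A = 1\<^sub>m (dim_row A')"
    using A by (auto simp: invertible_mat_def inverts_mat_def)
  have A'c: "A' \<in> carrier_mat n n"
    using A(1) A' by (metis carrier_matD(2) carrier_matI index_mult_mat(2,3) index_one_mat(2,3))
  define B where "B = A' * M"
  have B: "B \<in> carrier_mat n n" using A'c M by (simp add: B_def)
  have AB: "A * B = M"
    using A(1) A'c A'(1) M(1) by (simp add: B_def flip: assoc_mult_mat[of A n n A' n M n])
  define scl :: "real \<Rightarrow> (nat \<Rightarrow> real) \<Rightarrow> nat \<Rightarrow> real" where "scl c x = (\<lambda>i. c * x i)" for c x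
  define S where "S = mat_form n A"
  define T :: "(nat \<Rightarrow> real) \<Rightarrow> nat \<Rightarrow> real" where "T x = (\<lambda>i. \<Sum>j<n. B $$ (i, j) * x j)" for x
  have S_T: "S (T x) y = mat_form n M x y" for x y
  proof -
    have "S (T x) y = S y (T x)" unfolding S_def by (rule mat_form_sym) fact+
    also have "\<dots> = (\<Sum>i<n. \<Sum>j<n. \<Sum>k<n. A $$ (i, j) * B $$ (j, k) * y i * x k)"
      by (simp add: S_def mat_form_def T_def sum_distrib_left mult_ac)
    also have "\<dots> = (\<Sum>i<n. \<Sum>k<n. \<Sum>j<n. A $$ (i, j) * B $$ (j, k) * y i * x k)"
      by (intro sum.cong refl sum.swap)
    also have "\<dots> = (\<Sum>i<n. \<Sum>k<n. (A * B) $$ (i, k) * y i * x k)"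
      using A(1) B by (intro sum.cong refl)
        (simp add: scalar_prod_def lessThan_atLeast0 sum_distrib_right)
    also have "\<dots> = mat_form n M y x" by (simp add: AB mat_form_def)
    finally show ?thesis using mat_form_sym[OF M(2,1)] by simp
  qed
  interpret selfadjoint_operator scl S T
  proof unfold_locales
    show S_sym: "S x y = S y x" for x y unfolding S_def by (rule mat_form_sym) fact+
    show "S (T x) y = S x (T y)" for x y
      using S_T S_sym mat_form_sym[OF M(2,1)] by metis
    show "S (x + y) z = S x z + S y z" for x y z
      by (simp add: S_def mat_form_def algebra_simps sum.distrib)
    show "S (scl a x) z = a * S x z" for a x z
      by (simp add: S_def mat_form_def scl_def algebra_simps sum_distrib_left)
    show "T (x + y) = T x + T y" for x y
      by (auto simp: T_def algebra_simps sum.distrib)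
    show "T (scl a x) = scl a (T x)" for a x
      by (auto simp: T_def scl_def algebra_simps sum_distrib_left)
  qed (auto simp: scl_def algebra_simps)
  have S_unit: "S x y = (\<Sum>b<n. y b * S x (unit_fun b))" for x y
    unfolding S_def by (rule mat_form_unit_right)
  obtain P where P: "P \<noteq> 0" "\<And>x y. S (act P x) y = 0"
  proof -
    \<comment> \<open>Each of the n^2 + 1 powers of \<open>T\<close> gives n^2 numbers on pairs of
      unit vectors, so some nontrivial combination gives zero on all pairs; \<open>r\<close> encodes
      a pair by \<open>div\<close> and \<open>mod\<close>.\<close>
    obtain c where c: "\<exists>i<Suc (n * n). c i \<noteq> 0"
      "\<And>r. r < n * n \<Longrightarrow>
        (\<Sum>i<Suc (n * n). S (act (monom 1 i) (unit_fun (r div n))) (unit_fun (r mod n)) * c i) = 0"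
      using underdetermined_system_nontrivial[of "n * n" "Suc (n * n)"
          "\<lambda>r i. S (act (monom 1 i) (unit_fun (r div n))) (unit_fun (r mod n))"]
      by blast
    define P where "P = (\<Sum>i\<le>n * n. monom (c i) i)"
    have coeff_P: "coeff P i = (if i \<le> n * n then c i else 0)" for i
      by (simp add: P_def coeff_sum_monom)
    have "degree P \<le> n * n" by (rule degree_le) (simp add: coeff_P)
    have unit: "S (act P (unit_fun a)) (unit_fun b) = 0" if "a < n" "b < n" for a b
    proof -
      have r: "a * n + b < n * n" "(a * n + b) div n = a" "(a * n + b) mod n = b"
      proof -
        have "a * n + b < Suc a * n" using that by simp
        also have "\<dots> \<le> n * n" using that by (intro mult_le_mono1) simp
        finally show "a * n + b < n * n" .
      qed (use that in auto)
      have "S (act (P * 1) (unit_fun a)) (unit_fun b)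
          = (\<Sum>i\<le>n * n. coeff P i * S (act (monom 1 i * 1) (unit_fun a)) (unit_fun b))"
        by (rule S_act_expand) fact
      also have "\<dots> = 0"
        using c(2)[OF r(1)] r by (simp add: coeff_P lessThan_Suc_atMost mult.commute)
      finally show ?thesis by simp
    qed
    show ?thesis
    proof (rule that)
      show "P \<noteq> 0" using c(1) coeff_P by (metis coeff_0 less_Suc_eq_le)
      fix x y
      have "S (act P x) (unit_fun b) = 0" if "b < n" for b
      proof -
        have "S (act P x) (unit_fun b) = S (act P (unit_fun b)) x" by (metis S_act S_sym)
        also have "\<dots> = (\<Sum>a<n. x a * S (act P (unit_fun b)) (unit_fun a))" by (rule S_unit)
        finally show ?thesis using unit that by simp
      qed
      then show "S (act P x) y = 0" by (subst S_unit) simp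
    qed
  qed
  have bound: "m \<le> n" if "tridiagonal_family m e" for m e
  proof (rule ccontr)
    assume "\<not> m \<le> n"
    then have "n < m" by simp
    then obtain c where c: "\<exists>i<m. c i \<noteq> 0" "\<And>r. r < n \<Longrightarrow> (\<Sum>i<m. e i r * c i) = 0"
      by (rule underdetermined_system_nontrivial[of n m "\<lambda>r i. e i r"]) auto
    \<comment> \<open>A dependency among the values below \<open>n\<close>: \<open>z\<close> lies in
      the radical of \<open>S\<close>, yet pairing it with \<open>e j\<close> returns
      \<open>c j\<close> up to a nonzero factor.\<close>
    define z where "z = (\<Sum>i<m. scl (c i) (e i))"
    have "z r = 0" if "r < n" for r
      using c(2)[OF that] by (simp add: z_def scl_def sum_fun_apply mult.commute)
    then have "S z y = 0" for y by (simp add: S_def mat_form_def)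
    moreover have "S z (e j) = c j * S (e j) (e j)" if "j < m" for j
    proof -
      have "S z (e j) = (\<Sum>i<m. c i * S (e i) (e j))" by (simp add: z_def S_sum S_scale)
      also have "\<dots> = (\<Sum>i<m. if i = j then c j * S (e j) (e j) else 0)"
        using \<open>tridiagonal_family m e\<close> that
        by (intro sum.cong) (auto simp: tridiagonal_family_def)
      finally show ?thesis using that by simp
    qed
    ultimately have "\<forall>j<m. c j = 0"
      using \<open>tridiagonal_family m e\<close> by (auto simp: tridiagonal_family_def)
    with c(1) show False by auto
  qed
  obtain m e where fam: "tridiagonal_family m e"
    and complete: "\<And>x y. (\<And>i. i < m \<Longrightarrow> S x (e i) = 0) \<Longrightarrow> S x y = 0"
    by (rule complete_tridiagonal_family[of P n, OF P]) (use bound in auto)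
  have "\<not> m < n"
  proof
    assume "m < n"
    \<comment> \<open>The solution \<open>c\<close> is itself read as a vector: it is orthogonal to
      the whole family, so completeness puts it into the radical of \<open>S\<close>, that is, into
      the kernel of \<open>A\<close>.\<close>
    then obtain c where c: "\<exists>i<n. c i \<noteq> 0"
      "\<And>r. r < m \<Longrightarrow> (\<Sum>i<n. S (e r) (unit_fun i) * c i) = 0"
      by (rule underdetermined_system_nontrivial[of m n "\<lambda>r i. S (e r) (unit_fun i)"]) auto
    have "S c (e r) = 0" if "r < m" for r
      using c(2)[OF that] S_unit[of "e r" c] by (simp add: S_sym mult.commute)
    then have zero: "S c y = 0" for y by (rule complete)
    have "A *\<^sub>v vec n c = 0\<^sub>v n"
    proof (rule eq_vecI)
      fix i assume "i < dim_vec (0\<^sub>v n :: real vec)"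
      then have i: "i < n" by simp
      have "(A *\<^sub>v vec n c) $ i = (\<Sum>j<n. A $$ (i, j) * c j)"
        using A(1) i by (simp add: scalar_prod_def lessThan_atLeast0)
      also have "\<dots> = S (unit_fun i) c"
        using i by (simp add: S_def mat_form_def unit_fun_def if_distrib if_distribR
            sum.If_cases sum.swap cong: if_cong)
      also have "\<dots> = 0" by (subst S_sym) (rule zero)
      finally show "(A *\<^sub>v vec n c) $ i = 0\<^sub>v n $ i" using i by simp
    qed (use A in simp)
    moreover have "vec n c \<noteq> 0\<^sub>v n" using c(1) by (metis index_vec index_zero_vec(1))
    ultimately have "det A = 0"
      using det_0_iff_vec_prod_zero_field[OF A(1)] by (metis vec_carrier)
    with A show False by (simp add: invertible_mat_iff_det)
  qed
  with bound[OF fam] have "m = n" by simp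
  with fam that[of e] show ?thesis
    by (auto simp: tridiagonal_family_def S_T simp flip: S_def)
qed

section \<open>Simultaneous tridiagonalization by congruence\<close>

theorem lemma4p2:
  fixes K M :: "real mat" and n :: nat and \<gamma> :: real
  assumes "K \<in> carrier_mat n n" and "symmetric_mat K"
    and "M \<in> carrier_mat n n" and "symmetric_mat M"
    and "\<gamma> > 0"
    and "invertible_mat (K - \<gamma> \<cdot>\<^sub>m M)"
  shows "\<exists>U \<in> carrier_mat n n. invertible_mat U \<and>
           tridiagonal_mat (U\<^sup>T * K * U) \<and> tridiagonal_mat (U\<^sup>T * M * U) \<and>
           (\<forall>i. i + 1 < n \<longrightarrow>
              sign_definite {(U\<^sup>T * K * U) $$ (i, i + 1), (U\<^sup>T * M * U) $$ (i, i + 1)})"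
proof -
  define A where "A = K - \<gamma> \<cdot>\<^sub>m M"
  have A: "A \<in> carrier_mat n n" using assms by (simp add: A_def minus_carrier_mat)
  have "symmetric_mat A"
    unfolding symmetric_mat_def
    by (rule eq_matI)
       (use assms A symmetric_mat_index[OF assms(2,1)] symmetric_mat_index[OF assms(4,3)]
         in \<open>auto simp: A_def\<close>)
  then obtain e :: "nat \<Rightarrow> nat \<Rightarrow> real"
    where A_diag: "\<And>i. i < n \<Longrightarrow> mat_form n A (e i) (e i) \<noteq> 0"
      and A_off: "\<And>i j. i < n \<Longrightarrow> j < n \<Longrightarrow> i \<noteq> j \<Longrightarrow> mat_form n A (e i) (e j) = 0"
      and M_off: "\<And>i j. i < n \<Longrightarrow> j < n \<Longrightarrow> i + 2 \<le> j \<Longrightarrow> mat_form n M (e i) (e j) = 0"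
    using diagonal_tridiagonal_basis[OF A, of M] assms by (auto simp: A_def)
  define U where "U = mat n n (\<lambda>(r, c). e c r)"
  have U: "U \<in> carrier_mat n n" by (simp add: U_def)
  have entry: "(U\<^sup>T * X * U) $$ (i, j) = mat_form n X (e i) (e j)"
    if "X \<in> carrier_mat n n" "i < n" "j < n" for X i j
    unfolding U_def by (rule congruence_index) fact+
  have K_form: "mat_form n K x y = mat_form n A x y + \<gamma> * mat_form n M x y" for x y
  proof -
    have "K $$ (i, j) = A $$ (i, j) + \<gamma> * M $$ (i, j)" if "i < n" "j < n" for i j
      using assms that by (simp add: A_def)
    then show ?thesis
      by (simp add: mat_form_def algebra_simps sum.distrib sum_distrib_left)
  qed
  have "invertible_mat U"
  proof -
    \<comment> \<open>This congruence of \<open>A\<close> is diagonal with nonzero diagonal, so its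
      determinant is nonzero, and \<open>det U\<close> is a factor of it.\<close>
    let ?D = "U\<^sup>T * A * U"
    have D: "?D \<in> carrier_mat n n" using U A by simp
    have "det ?D = prod_list (diag_mat ?D)"
    proof (rule det_upper_triangular[OF upper_triangularI D])
      fix i j assume "j < i" "i < dim_row ?D"
      then have "i < n" "j < n" "i \<noteq> j" using D by auto
      then show "?D $$ (i, j) = 0" by (simp only: entry[OF A]) (rule A_off)
    qed
    moreover have "0 \<notin> set (diag_mat ?D)"
    proof
      assume "0 \<in> set (diag_mat ?D)"
      then have "\<exists>i<n. ?D $$ (i, i) = 0"
        unfolding diag_mat_def carrier_matD(1)[OF D] set_map set_upt by force
      then obtain i where i: "i < n" "?D $$ (i, i) = 0" by blast
      then have "mat_form n A (e i) (e i) = 0" by (simp only: entry[OF A])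
      with A_diag[OF i(1)] show False ..
    qed
    ultimately have "det ?D \<noteq> 0" by (simp only: prod_list_zero_iff not_False_eq_True)
    moreover have "det ?D = det (U\<^sup>T * A) * det U"
      by (rule det_mult[of _ n]) (use U A in auto)
    ultimately have "det U \<noteq> 0" by auto
    then show ?thesis using U by (simp add: invertible_mat_iff_det)
  qed
  moreover have tri: "tridiagonal_mat (U\<^sup>T * X * U)"
    if X: "X \<in> carrier_mat n n" "symmetric_mat X"
      and off: "\<And>i j. i < n \<Longrightarrow> j < n \<Longrightarrow> i + 2 \<le> j \<Longrightarrow> mat_form n X (e i) (e j) = 0" for X
  proof -
    have dims: "dim_row (U\<^sup>T * X * U) = n" "dim_col (U\<^sup>T * X * U) = n" using U by auto
    have "symmetric_mat (U\<^sup>T * X * U)"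
      unfolding symmetric_mat_def
    proof (rule eq_matI)
      fix i j assume "i < dim_row (U\<^sup>T * X * U)" "j < dim_col (U\<^sup>T * X * U)"
      then have ij: "i < n" "j < n" by (simp_all only: dims)
      then have "(U\<^sup>T * X * U)\<^sup>T $$ (i, j) = (U\<^sup>T * X * U) $$ (j, i)"
        by (intro index_transpose_mat(1)) (simp_all only: dims)
      then show "(U\<^sup>T * X * U)\<^sup>T $$ (i, j) = (U\<^sup>T * X * U) $$ (i, j)"
        using ij mat_form_sym[OF X(2,1)] by (simp only: entry[OF X(1)])
    qed (simp_all only: dims index_transpose_mat)
    moreover have "mat_form n X (e i) (e j) = 0"
      if "i < n" "j < n" "\<bar>int i - int j\<bar> \<ge> 2" for i j
    proof (cases "i < j")
      case True
      then show ?thesis using that by (intro off) auto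
    next
      case False
      then have "mat_form n X (e j) (e i) = 0" using that by (intro off) auto
      then show ?thesis using mat_form_sym[OF X(2,1)] by simp
    qed
    ultimately show ?thesis
      unfolding tridiagonal_mat_def dims using entry[OF X(1)] by metis
  qed
  moreover have "tridiagonal_mat (U\<^sup>T * K * U)" "tridiagonal_mat (U\<^sup>T * M * U)"
    using assms by (auto intro!: tri simp: K_form A_off M_off)
  moreover have "sign_definite {(U\<^sup>T * K * U) $$ (i, i + 1), (U\<^sup>T * M * U) $$ (i, i + 1)}"
    if "i + 1 < n" for i
  proof -
    \<comment> \<open>The form of \<open>A\<close> contributes nothing off the diagonal, and
      \<open>\<gamma> > 0\<close> then gives both entries the same sign.\<close>
    have "(U\<^sup>T * K * U) $$ (i, i + 1) = \<gamma> * (U\<^sup>T * M * U) $$ (i, i + 1)"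
      using that assms(1,3) by (simp add: entry K_form A_off del: index_mult_mat)
    then show ?thesis
      using \<open>\<gamma> > 0\<close>
      by (cases "(U\<^sup>T * M * U) $$ (i, i + 1) \<ge> 0")
         (auto simp: sign_definite_def mult_nonneg_nonpos)
  qed
  ultimately show ?thesis using U by blast
qed

end
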